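(* Let $\gamma=(x,z):(I,t_0)\to(\mathbb{R}^2,0)$ be a smooth curve germ and $k$ a non-negative integer. If $\operatorname{ord}(x)(t_0)=k+1$ and $z$ is regular at $t_0$ (i.e. $\dot z(t_0)\neq0$), then $\gamma$ is equivalent to one of the germs $t\mapsto(\pm t^{k+1},t)$ at $0$ in the following sense: for a suitable choice of the sign $\pm$, setting $\widetilde\gamma(t)=(\pm t^{k+1},t)$, there exist diffeomorphism germs $\phi:(I,t_0)\to(\mathbb{R},0)$ and $\psi:(\mathbb{R}^2,0)\to(\mathbb{R}^2,0)$ of the form $\psi(X,Z)=(X,\varphi(X^2,Z))$, with $\varphi:(\mathbb{R}^2,0)\to(\mathbb{R},0)$ a smooth function germ, such that $\psi\circ\gamma=\widetilde\gamma\circ\phi$.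
   Context: All maps are $C^\infty$. For a smooth function germ $f:(I,t_0)\to\mathbb{R}$ and integer $k\ge0$, $\operatorname{ord}(f)(t_0)=k+1$ means $f(t_0)=\dot f(t_0)=\cdots=f^{(k)}(t_0)=0$ and $f^{(k+1)}(t_0)\neq0$. *)

theory Defs
  imports "HOL-Analysis.Analysis"
begin

text \<open>
  A function is \<open>C\<^sup>n\<close> on an open set if it is differentiable there and all its directional
  derivatives are \<open>C\<^sup>n\<^sup>-\<^sup>1\<close>. The definition is meant for open sets \<open>S\<close> only, since the derivatives
  are taken in the full space.
\<close>

primrec cont_diff_on ::
    "nat \<Rightarrow> ('a::euclidean_space \<Rightarrow> 'b::euclidean_space) \<Rightarrow> 'a set \<Rightarrow> bool" where
  "cont_diff_on 0 f S \<longleftrightarrow> continuous_on S f"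
| "cont_diff_on (Suc n) f S \<longleftrightarrow>
     (\<forall>x\<in>S. f differentiable (at x)) \<and>
     (\<forall>v. cont_diff_on n (\<lambda>x. frechet_derivative f (at x) v) S)"

definition smooth_on ::
    "('a::euclidean_space \<Rightarrow> 'b::euclidean_space) \<Rightarrow> 'a set \<Rightarrow> bool" where
  "smooth_on f S \<longleftrightarrow> (\<forall>n. cont_diff_on n f S)"

text \<open>
  Germs are handled through representatives, which are total functions whose values away from
  the base point are irrelevant. Equality of germs at \<open>a\<close> is equality eventually in \<open>nhds a\<close>.
\<close>

definition smooth_germ ::
    "('a::euclidean_space \<Rightarrow> 'b::euclidean_space) \<Rightarrow> 'a \<Rightarrow> 'b \<Rightarrow> bool" where
  "smooth_germ f a b \<longleftrightarrow> (\<exists>U. open U \<and> a \<in> U \<and> smooth_on f U) \<and> f a = b"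

definition diffeo_germ ::
    "('a::euclidean_space \<Rightarrow> 'b::euclidean_space) \<Rightarrow> 'a \<Rightarrow> 'b \<Rightarrow> bool" where
  "diffeo_germ f a b \<longleftrightarrow> smooth_germ f a b \<and>
     (\<exists>g. smooth_germ g b a \<and>
          (\<forall>\<^sub>F p in nhds a. g (f p) = p) \<and> (\<forall>\<^sub>F q in nhds b. f (g q) = q))"

definition has_ord :: "(real \<Rightarrow> real) \<Rightarrow> real \<Rightarrow> nat \<Rightarrow> bool" where
  "has_ord f t0 m \<longleftrightarrow> (\<forall>i<m. (deriv ^^ i) f t0 = 0) \<and> (deriv ^^ m) f t0 \<noteq> 0"

end

theory Submission
  imports Defs
begin

text \<open>
  Both \<open>x\<close> and \<open>z\<close> can be expressed through a single coordinate \<open>\<phi>\<close> of the line, and the passage from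
  \<open>z\<close> to \<open>\<phi>\<close> is a change of the coordinate \<open>Z\<close> of the plane.

  Since \<open>x\<close> has order \<open>k + 1\<close> at \<open>t\<^sub>0\<close>, it is up to sign the \<open>(k + 1)\<close>-st power of a local
  coordinate \<open>\<phi>\<close> of the line: Hadamard's integral formula gives \<open>x(t) = (t - t\<^sub>0)\<^sup>k\<^sup>+\<^sup>1 u(t)\<close> with \<open>u\<close>
  smooth and \<open>u(t\<^sub>0) \<noteq> 0\<close> (\<open>has_ord_factor\<close>), and a root of \<open>\<bar>u\<bar>\<close> can be distributed over the linear
  factor (\<open>has_ord_eq_signed_power\<close>). The sign \<open>\<epsilon>\<close> is the sign of \<open>u(t\<^sub>0)\<close>.

  Since \<open>z\<close> is regular, it is itself a coordinate of the line by the inverse function theorem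
  (\<open>smooth_germ_deriv_nonzero_imp_diffeo_germ\<close>). Hence \<open>h = \<phi> \<circ> z\<^sup>-\<^sup>1\<close> is a diffeomorphism germ
  with \<open>h \<circ> z = \<phi>\<close>, and \<open>\<psi>(X, Z) = (X, h(Z))\<close> sends \<open>(x, z)\<close> to \<open>(x, \<phi>) = (\<epsilon> \<phi>\<^sup>k\<^sup>+\<^sup>1, \<phi>)\<close>. The map
  \<open>\<psi>\<close> has the required form \<open>(X, \<eta>(X\<^sup>2, Z))\<close> for a function \<open>\<eta>\<close> of its second argument alone.

  What has to be developed is the calculus of \<open>C\<^sup>n\<close> maps. Products and compositions suffice when
  the outer function of a composition depends on one real variable, because \<open>\<psi>\<close> is assembled from
  \<open>h\<close> and linear projections.
\<close>

section \<open>Calculus of smooth maps\<close>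

lemma cont_diff_on_cong:
  assumes "open S" "\<And>x. x \<in> S \<Longrightarrow> f x = g x"
  shows "cont_diff_on n f S \<longleftrightarrow> cont_diff_on n g S"
  using assms(2)
proof (induction n arbitrary: f g)
  case 0
  then show ?case by (auto intro: continuous_on_cong)
next
  case (Suc n)
  have D: "(f has_derivative L) (at x) \<longleftrightarrow> (g has_derivative L) (at x)" if "x \<in> S" for x L
    using has_derivative_transform_within_open[OF _ assms(1) that] Suc.prems by metis
  then have "frechet_derivative f (at x) = frechet_derivative g (at x)" if "x \<in> S" for x
    using that by (simp add: frechet_derivative_def)
  then have "cont_diff_on n (\<lambda>x. frechet_derivative f (at x) v) S
      \<longleftrightarrow> cont_diff_on n (\<lambda>x. frechet_derivative g (at x) v) S" for v
    by (intro Suc.IH) simp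
  with D show ?case by (simp add: differentiable_def)
qed

lemma cont_diff_on_SucI:
  assumes "open S" "\<And>x. x \<in> S \<Longrightarrow> (f has_derivative f' x) (at x)"
    and "\<And>v. cont_diff_on n (\<lambda>x. f' x v) S"
  shows "cont_diff_on (Suc n) f S"
proof -
  have "frechet_derivative f (at x) = f' x" if "x \<in> S" for x
    using frechet_derivative_at[OF assms(2)[OF that]] by simp
  then have "cont_diff_on n (\<lambda>x. frechet_derivative f (at x) v) S" for v
    using assms(3)[of v] by (subst cont_diff_on_cong[OF assms(1)]) auto
  with assms(2) show ?thesis by (auto simp: differentiable_def)
qed

lemma cont_diff_on_Suc_has_derivative:
  "cont_diff_on (Suc n) f S \<Longrightarrow> x \<in> S \<Longrightarrow> (f has_derivative frechet_derivative f (at x)) (at x)"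
  by (simp add: frechet_derivative_works[symmetric])

lemma cont_diff_on_Suc_imp: "cont_diff_on (Suc n) f S \<Longrightarrow> cont_diff_on n f S"
proof (induction n arbitrary: f)
  case 0
  then show ?case
    by (auto intro!: continuous_at_imp_continuous_on differentiable_imp_continuous_within)
next
  case (Suc n)
  have "cont_diff_on (Suc n) (\<lambda>x. frechet_derivative f (at x) v) S" for v
    using Suc.prems by (subst (asm) cont_diff_on.simps(2)) blast
  then have "cont_diff_on n (\<lambda>x. frechet_derivative f (at x) v) S" for v
    by (rule Suc.IH)
  moreover have "\<forall>x\<in>S. f differentiable (at x)"
    using Suc.prems by (subst (asm) cont_diff_on.simps(2)) blast
  ultimately show ?case by (subst cont_diff_on.simps(2)) blast
qed

lemma cont_diff_on_imp_continuous_on: "cont_diff_on n f S \<Longrightarrow> continuous_on S f"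
  by (induction n) (simp, blast intro: cont_diff_on_Suc_imp)

lemma cont_diff_on_subset: "cont_diff_on n f S \<Longrightarrow> T \<subseteq> S \<Longrightarrow> cont_diff_on n f T"
  by (induction n arbitrary: f) (auto intro: continuous_on_subset)

lemma cont_diff_on_const: "open S \<Longrightarrow> cont_diff_on n (\<lambda>x. c) S"
proof (induction n arbitrary: c)
  case (Suc n)
  show ?case
    by (rule cont_diff_on_SucI[OF Suc.prems has_derivative_const Suc.IH[OF Suc.prems]])
qed simp

lemma cont_diff_on_linear_compose:
  assumes "bounded_linear L" "open S"
  shows "cont_diff_on n f S \<Longrightarrow> cont_diff_on n (\<lambda>x. L (f x)) S"
proof (induction n arbitrary: f)
  case 0
  then show ?case by (simp add: bounded_linear.continuous_on[OF assms(1)])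
next
  case (Suc n)
  show ?case
  proof (rule cont_diff_on_SucI[OF assms(2)])
    show "((\<lambda>x. L (f x)) has_derivative (\<lambda>v. L (frechet_derivative f (at x) v))) (at x)"
      if "x \<in> S" for x
      using bounded_linear.has_derivative[OF assms(1)
          cont_diff_on_Suc_has_derivative[OF Suc.prems that]] .
    show "cont_diff_on n (\<lambda>x. L (frechet_derivative f (at x) v)) S" for v
      using Suc by simp
  qed
qed

lemma cont_diff_on_linear:
  assumes "bounded_linear L" "open S"
  shows "cont_diff_on n L S"
proof (cases n)
  case 0
  then show ?thesis by (simp add: assms(1) linear_continuous_on)
next
  case (Suc m)
  show ?thesis unfolding Suc
    by (rule cont_diff_on_SucI[where f' = "\<lambda>_. L"])
      (use assms in \<open>auto intro: bounded_linear_imp_has_derivative cont_diff_on_const\<close>)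
qed

lemma cont_diff_on_add:
  assumes "open S"
  shows "cont_diff_on n f S \<Longrightarrow> cont_diff_on n g S \<Longrightarrow> cont_diff_on n (\<lambda>x. f x + g x) S"
proof (induction n arbitrary: f g)
  case 0
  then show ?case by (simp add: continuous_on_add)
next
  case (Suc n)
  show ?case
  proof (rule cont_diff_on_SucI[OF assms])
    show "((\<lambda>x. f x + g x) has_derivative
        (\<lambda>v. frechet_derivative f (at x) v + frechet_derivative g (at x) v)) (at x)"
      if "x \<in> S" for x
      using Suc.prems that by (intro has_derivative_add cont_diff_on_Suc_has_derivative)
    show "cont_diff_on n (\<lambda>x. frechet_derivative f (at x) v + frechet_derivative g (at x) v) S"
      for v using Suc by simp
  qed
qed

lemma cont_diff_on_mult:
  fixes f g :: "'a::euclidean_space \<Rightarrow> real"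
  assumes "open S"
  shows "cont_diff_on n f S \<Longrightarrow> cont_diff_on n g S \<Longrightarrow> cont_diff_on n (\<lambda>x. f x * g x) S"
proof (induction n arbitrary: f g)
  case 0
  then show ?case by (simp add: continuous_on_mult)
next
  case (Suc n)
  show ?case
  proof (rule cont_diff_on_SucI[OF assms])
    show "((\<lambda>x. f x * g x) has_derivative
        (\<lambda>v. f x * frechet_derivative g (at x) v + frechet_derivative f (at x) v * g x)) (at x)"
      if "x \<in> S" for x
      using Suc.prems that by (intro has_derivative_mult cont_diff_on_Suc_has_derivative)
    show "cont_diff_on n
        (\<lambda>x. f x * frechet_derivative g (at x) v + frechet_derivative f (at x) v * g x) S" for v
      using Suc.prems Suc.prems[THEN cont_diff_on_Suc_imp]
      by (intro cont_diff_on_add[OF assms] Suc.IH) auto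
  qed
qed

lemma cont_diff_on_Pair:
  assumes "open S" "cont_diff_on n f S" "cont_diff_on n g S"
  shows "cont_diff_on n (\<lambda>x. (f x, g x)) S"
proof -
  have "cont_diff_on n (\<lambda>x. (f x, 0) + (0, g x)) S"
    \<comment> \<open>each summand is a linear embedding applied to \<open>f\<close> or \<open>g\<close>\<close>
    by (rule cont_diff_on_add[OF assms(1)];
        rule cont_diff_on_linear_compose[OF _ assms(1)])
      (auto intro!: assms bounded_linear_Pair bounded_linear_ident bounded_linear_zero)
  then show ?thesis by simp
qed

text \<open>
  On the real line a Frechet derivative is multiplication by the ordinary derivative, so a
  differentiable \<open>f\<close> is \<open>C\<^sup>n\<^sup>+\<^sup>1\<close> exactly if \<open>f'\<close> is \<open>C\<^sup>n\<close>; the directions \<open>v\<close> disappear.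
\<close>

lemma cont_diff_on_Suc_realI:
  fixes f :: "real \<Rightarrow> real"
  assumes "open S" "\<And>x. x \<in> S \<Longrightarrow> (f has_field_derivative f' x) (at x)" "cont_diff_on n f' S"
  shows "cont_diff_on (Suc n) f S"
proof (rule cont_diff_on_SucI[OF assms(1)])
  show "(f has_derivative (\<lambda>v. f' x * v)) (at x)" if "x \<in> S" for x
    using assms(2)[OF that] by (simp add: has_field_derivative_def)
  show "cont_diff_on n (\<lambda>x. f' x * v) S" for v
    by (rule cont_diff_on_mult[OF assms(1) assms(3) cont_diff_on_const[OF assms(1)]])
qed

lemma cont_diff_on_Suc_real_has_deriv:
  fixes f :: "real \<Rightarrow> real"
  assumes "cont_diff_on (Suc n) f S" "x \<in> S"
  shows "(f has_field_derivative deriv f x) (at x)"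
  using assms by (simp add: DERIV_deriv_iff_real_differentiable)

lemma cont_diff_on_deriv:
  fixes f :: "real \<Rightarrow> real"
  assumes "open S" "cont_diff_on (Suc n) f S"
  shows "cont_diff_on n (deriv f) S"
proof -
  have "deriv f x = frechet_derivative f (at x) 1" if "x \<in> S" for x
    using frechet_derivative_at[OF
        cont_diff_on_Suc_real_has_deriv[OF assms(2) that, unfolded has_field_derivative_def]]
    by (metis mult.right_neutral)
  moreover have "cont_diff_on n (\<lambda>x. frechet_derivative f (at x) 1) S"
    using assms(2) by simp
  ultimately show ?thesis
    by (subst cont_diff_on_cong[OF assms(1)])
qed

text \<open>
  With a one-variable outer function the chain rule reads \<open>(g \<circ> f)' v = g'(f) * f' v\<close>, a product
  of functions that are one degree less differentiable, and induction applies to its first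
  factor.
\<close>

lemma cont_diff_on_compose:
  fixes f :: "'a::euclidean_space \<Rightarrow> real" and g :: "real \<Rightarrow> real"
  assumes "open S" "open T" "f ` S \<subseteq> T"
  shows "cont_diff_on n g T \<Longrightarrow> cont_diff_on n f S \<Longrightarrow> cont_diff_on n (\<lambda>x. g (f x)) S"
proof (induction n arbitrary: g)
  case 0
  then show ?case using assms by (auto intro: continuous_on_compose2)
next
  case (Suc n)
  show ?case
  proof (rule cont_diff_on_SucI[OF assms(1)])
    fix x assume x: "x \<in> S"
    then have "(g has_field_derivative deriv g (f x)) (at (f x))"
      using assms(3) by (intro cont_diff_on_Suc_real_has_deriv[OF Suc.prems(1)]) auto
    then have "(g has_derivative (*) (deriv g (f x))) (at (f x))"
      by (simp only: has_field_derivative_def)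
    then show "((\<lambda>x. g (f x)) has_derivative
        (\<lambda>v. deriv g (f x) * frechet_derivative f (at x) v)) (at x)"
      by (rule has_derivative_compose[OF cont_diff_on_Suc_has_derivative[OF Suc.prems(2) x]])
  next
    show "cont_diff_on n (\<lambda>x. deriv g (f x) * frechet_derivative f (at x) v) S" for v
    proof (rule cont_diff_on_mult[OF assms(1)])
      show "cont_diff_on n (\<lambda>x. deriv g (f x)) S"
        by (rule Suc.IH[OF cont_diff_on_deriv[OF assms(2) Suc.prems(1)]
              cont_diff_on_Suc_imp[OF Suc.prems(2)]])
      show "cont_diff_on n (\<lambda>x. frechet_derivative f (at x) v) S"
        using Suc.prems(2) by simp
    qed
  qed
qed

lemma cont_diff_on_inverse: "cont_diff_on n (inverse :: real \<Rightarrow> real) (- {0})"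
proof (induction n)
  case 0
  then show ?case by (auto intro!: continuous_intros)
next
  case (Suc n)
  have o: "open (- {0::real})" by auto
  have "cont_diff_on n (\<lambda>y::real. (- 1) * (inverse y * inverse y)) (- {0})"
    by (intro cont_diff_on_mult[OF o] cont_diff_on_const[OF o] Suc)
  then show ?case
    by (intro cont_diff_on_Suc_realI[OF o]) (auto intro!: derivative_eq_intros)
qed

text \<open>
  The exponent is arbitrary because differentiation lowers it by one.
\<close>

lemma cont_diff_on_powr: "cont_diff_on n (\<lambda>y::real. y powr a) {0<..}"
proof (induction n arbitrary: a)
  case 0
  then show ?case by (auto intro!: continuous_intros)
next
  case (Suc n)
  have o: "open {0::real<..}" by auto
  have "cont_diff_on n (\<lambda>y::real. a * y powr (a - 1)) {0<..}"
    by (intro cont_diff_on_mult[OF o] cont_diff_on_const[OF o] Suc)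
  then show ?case
    by (rule cont_diff_on_Suc_realI[OF o, rotated]) (auto intro!: derivative_eq_intros)
qed

section \<open>Factoring out the zero of a smooth function\<close>

lemma segment_in_ball:
  fixes a s t :: real
  assumes "t \<in> ball a r" "s \<in> {0..1}"
  shows "a + s * (t - a) \<in> ball a r"
proof -
  have "\<bar>s * (t - a)\<bar> \<le> \<bar>t - a\<bar>"
    using assms by (simp add: abs_mult mult_left_le_one_le)
  then show ?thesis using assms by (simp add: dist_real_def)
qed

text \<open>
  Differentiating under the integral turns \<open>f\<close> into \<open>f'\<close> and raises the exponent of the weight
  \<open>s\<close> by one; this is why the weight has an arbitrary exponent.
\<close>

lemma cont_diff_on_weighted_average:
  fixes f :: "real \<Rightarrow> real"
  assumes "r > 0"
  shows "cont_diff_on n f (ball a r) \<Longrightarrow>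
    cont_diff_on n (\<lambda>t. integral {0..1} (\<lambda>s. s ^ j * f (a + s * (t - a)))) (ball a r)"
proof (induction n arbitrary: f j)
  note seg = segment_in_ball
  have cont: "continuous_on (ball a r \<times> {0..1}) (\<lambda>(t, s). s ^ i * h (a + s * (t - a)))"
    if "continuous_on (ball a r) h" for h :: "real \<Rightarrow> real" and i
    unfolding case_prod_beta
    by (intro continuous_intros continuous_on_compose2[OF that]) (use seg in auto)
  {
    case 0
    then show ?case
      using integral_continuous_on_param[of "ball a r" 0 1
          "\<lambda>t s. s ^ j * f (a + s * (t - a))"] cont[of f j] by simp
  next
    case (Suc n)
    have cf: "continuous_on (ball a r) f" and cf': "continuous_on (ball a r) (deriv f)"
      by (intro cont_diff_on_imp_continuous_on[OF Suc.prems]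
          cont_diff_on_imp_continuous_on[OF cont_diff_on_deriv[OF open_ball Suc.prems]])+
    show ?case
    proof (rule cont_diff_on_Suc_realI)
      fix t assume t: "t \<in> ball a r"
      have D: "((\<lambda>t. s ^ j * f (a + s * (t - a))) has_field_derivative
          s ^ Suc j * deriv f (a + s * (t - a))) (at t within ball a r)"
        if "t \<in> ball a r" "s \<in> {0..1}" for t s
      proof -
        have "((\<lambda>t. f (a + s * (t - a))) has_field_derivative deriv f (a + s * (t - a)) * s) (at t)"
          by (rule DERIV_chain2[where g = "\<lambda>t. a + s * (t - a)",
                OF cont_diff_on_Suc_real_has_deriv[OF Suc.prems seg[OF that]]])
            (auto intro!: derivative_eq_intros)
        from DERIV_cmult[OF this, of "s ^ j"] show ?thesis
          by (auto intro: has_field_derivative_at_within simp: mult_ac)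
      qed
      have "((\<lambda>t. integral (cbox 0 1) (\<lambda>s. s ^ j * f (a + s * (t - a)))) has_field_derivative
          integral (cbox 0 1) (\<lambda>s. s ^ Suc j * deriv f (a + s * (t - a)))) (at t within ball a r)"
      proof (rule leibniz_rule_field_derivative)
        show "(\<lambda>s. s ^ j * f (a + s * (t - a))) integrable_on cbox 0 1" if "t \<in> ball a r" for t
          using that seg
          by (intro integrable_continuous continuous_intros continuous_on_compose2[OF cf]) auto
      qed (use D t cont[OF cf', of "Suc j"] in auto)
      then show "((\<lambda>t. integral {0..1} (\<lambda>s. s ^ j * f (a + s * (t - a)))) has_field_derivative
          integral {0..1} (\<lambda>s. s ^ Suc j * deriv f (a + s * (t - a)))) (at t)"
        using t by (simp add: at_within_open[of t "ball a r"])
    next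
      show "cont_diff_on n
          (\<lambda>t. integral {0..1} (\<lambda>s. s ^ Suc j * deriv f (a + s * (t - a)))) (ball a r)"
        by (rule Suc.IH[OF cont_diff_on_deriv[OF open_ball Suc.prems]])
    qed simp
  }
qed

text \<open>
  The argument is an induction on \<open>m\<close>. For \<open>m > 0\<close> the derivative has order \<open>m - 1\<close>, hence \<open>f'(t) = (t - a)\<^sup>m\<^sup>-\<^sup>1 v(t)\<close>. Integrating
  along the segment from \<open>a\<close> to \<open>t\<close> gives \<open>f(t) = (t - a)\<^sup>m u(t)\<close>, where \<open>u(t)\<close> is the average of
  \<open>v\<close> over that segment with weight \<open>s\<^sup>m\<^sup>-\<^sup>1\<close>; in particular \<open>u(a) = v(a) / m\<close>.
\<close>

lemma has_ord_factor:
  fixes f :: "real \<Rightarrow> real"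
  assumes "r > 0" "smooth_on f (ball a r)" "has_ord f a m"
  obtains u where "smooth_on u (ball a r)" "u a \<noteq> 0"
    "\<And>t. t \<in> ball a r \<Longrightarrow> f t = (t - a) ^ m * u t"
proof -
  have "\<exists>u. smooth_on u (ball a r) \<and> u a \<noteq> 0 \<and> (\<forall>t\<in>ball a r. f t = (t - a) ^ m * u t)"
    using assms(2,3)
  proof (induction m arbitrary: f)
    case 0
    then show ?case by (intro exI[of _ f]) (auto simp: has_ord_def)
  next
    case (Suc m)
    have ord: "has_ord (deriv f) a m" and f0: "f a = 0"
      using Suc.prems(2) by (fastforce simp: has_ord_def funpow_Suc_right simp del: funpow.simps)+
    have sm: "smooth_on (deriv f) (ball a r)"
      using Suc.prems(1) cont_diff_on_deriv[OF open_ball] by (simp add: smooth_on_def del: cont_diff_on.simps)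
    obtain v where v: "smooth_on v (ball a r)" "v a \<noteq> 0"
      and fv: "\<And>t. t \<in> ball a r \<Longrightarrow> deriv f t = (t - a) ^ m * v t"
      using Suc.IH[OF sm ord] by blast
    define u where "u t = integral {0..1} (\<lambda>s. s ^ m * v (a + s * (t - a)))" for t
    have "smooth_on u (ball a r)"
      using v(1) cont_diff_on_weighted_average[OF assms(1)]
      unfolding smooth_on_def u_def by blast
    moreover have "u a \<noteq> 0"
    proof -
      have "((\<lambda>s. s ^ Suc m / Suc m) has_vector_derivative s ^ m) (at s within {0..1})" for s :: real
        unfolding has_real_derivative_iff_has_vector_derivative[symmetric]
        by (rule derivative_eq_intros refl | simp)+
      from fundamental_theorem_of_calculus[OF _ this]
      have "((\<lambda>s::real. s ^ m) has_integral 1 / Suc m) {0..1}" by simp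
      then have "integral {0..1} (\<lambda>s::real. s ^ m * v a) = (1 / Suc m) * v a"
        by (intro integral_unique has_integral_mult_left)
      moreover have "u a = integral {0..1} (\<lambda>s::real. s ^ m * v a)"
        unfolding u_def by (simp only: diff_self mult_zero_right add_0_right)
      ultimately have "u a = (1 / Suc m) * v a" by (simp only:)
      then show ?thesis using v(2) by simp
    qed
    moreover have "f t = (t - a) ^ Suc m * u t" if t: "t \<in> ball a r" for t
    proof -
      note seg = segment_in_ball[OF t]
      have "((\<lambda>s. f (a + s * (t - a))) has_vector_derivative
          (t - a) ^ Suc m * (s ^ m * v (a + s * (t - a)))) (at s within {0..1})"
        if s: "s \<in> {0..1}" for s
      proof -
        have "(f has_field_derivative deriv f (a + s * (t - a))) (at (a + s * (t - a)))"
          using Suc.prems(1) seg[OF s] cont_diff_on_Suc_real_has_deriv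
          unfolding smooth_on_def by blast
        then have "((\<lambda>s. f (a + s * (t - a))) has_field_derivative
            deriv f (a + s * (t - a)) * (t - a)) (at s)"
          by (rule DERIV_chain2[where g = "\<lambda>s. a + s * (t - a)"]) (auto intro!: derivative_eq_intros)
        moreover have "deriv f (a + s * (t - a)) * (t - a)
            = (t - a) ^ Suc m * (s ^ m * v (a + s * (t - a)))"
          by (simp add: fv[OF seg[OF s]] power_mult_distrib)
        ultimately show ?thesis
          by (simp add: has_real_derivative_iff_has_vector_derivative
              has_vector_derivative_at_within)
      qed
      from fundamental_theorem_of_calculus[OF _ this]
      have "((\<lambda>s. (t - a) ^ Suc m * (s ^ m * v (a + s * (t - a)))) has_integral f t) {0..1}"
        using f0 by simp
      then have "f t = integral {0..1} (\<lambda>s. (t - a) ^ Suc m * (s ^ m * v (a + s * (t - a))))"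
        by (rule integral_unique[symmetric])
      then show ?thesis by (simp only: u_def integral_mult_right)
    qed
    ultimately show ?case by blast
  qed
  with that show thesis by blast
qed

section \<open>Smooth germs and diffeomorphism germs\<close>

lemma smooth_germ_compose:
  fixes f :: "'a::euclidean_space \<Rightarrow> real" and g :: "real \<Rightarrow> real"
  assumes "smooth_germ g b c" "smooth_germ f a b"
  shows "smooth_germ (\<lambda>x. g (f x)) a c"
proof -
  obtain T where T: "open T" "b \<in> T" "smooth_on g T" and gb: "g b = c"
    using assms(1) by (auto simp: smooth_germ_def)
  obtain U where U: "open U" "a \<in> U" "smooth_on f U" and fa: "f a = b"
    using assms(2) by (auto simp: smooth_germ_def)
  have "continuous_on U f"
    using U(3) by (metis smooth_on_def cont_diff_on.simps(1))
  then have o: "open (U \<inter> f -` T)"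
    using T(1) U(1) continuous_open_preimage by blast
  have "cont_diff_on n (\<lambda>x. g (f x)) (U \<inter> f -` T)" for n
  proof (rule cont_diff_on_compose[where f = f and g = g, OF o T(1)])
    show "cont_diff_on n g T" using T(3) by (simp add: smooth_on_def)
    show "cont_diff_on n f (U \<inter> f -` T)"
      using U(3) by (auto simp: smooth_on_def intro: cont_diff_on_subset[of n f U])
  qed auto
  with o U T fa gb show ?thesis
    by (auto simp: smooth_germ_def smooth_on_def intro!: exI[of _ "U \<inter> f -` T"])
qed

lemma smooth_germ_linear: "bounded_linear L \<Longrightarrow> L a = b \<Longrightarrow> smooth_germ L a b"
  by (auto simp: smooth_germ_def smooth_on_def intro!: exI[of _ UNIV] cont_diff_on_linear)

lemma smooth_germ_linear_compose:
  "bounded_linear L \<Longrightarrow> smooth_germ f a b \<Longrightarrow> smooth_germ (\<lambda>x. L (f x)) a (L b)"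
  unfolding smooth_germ_def smooth_on_def using cont_diff_on_linear_compose by blast

lemma smooth_germ_Pair:
  assumes "smooth_germ f a b" "smooth_germ g a c"
  shows "smooth_germ (\<lambda>x. (f x, g x)) a (b, c)"
proof -
  obtain U V where "open U" "a \<in> U" "smooth_on f U" "open V" "a \<in> V" "smooth_on g V"
    using assms by (auto simp: smooth_germ_def)
  then show ?thesis
    using assms unfolding smooth_germ_def smooth_on_def
    by (intro conjI exI[of _ "U \<inter> V"] allI cont_diff_on_Pair)
      (auto intro: cont_diff_on_subset)
qed

lemma smooth_germ_tendsto:
  assumes "smooth_germ f a b"
  shows "filterlim f (nhds b) (nhds a)"
proof -
  obtain U where "open U" "a \<in> U" "smooth_on f U" and b: "f a = b"
    using assms by (auto simp: smooth_germ_def)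
  then have "continuous_on U f" by (metis smooth_on_def cont_diff_on.simps(1))
  then have "isCont f a" using \<open>open U\<close> \<open>a \<in> U\<close> by (simp add: continuous_on_eq_continuous_at)
  then show ?thesis
    unfolding b[symmetric] by (simp only: isCont_def tendsto_at_iff_tendsto_nhds)
qed

lemma diffeo_germ_compose:
  fixes f g :: "real \<Rightarrow> real"
  assumes "diffeo_germ f a b" "diffeo_germ g b c"
  shows "diffeo_germ (\<lambda>x. g (f x)) a c"
proof -
  obtain f' where f: "smooth_germ f a b" "smooth_germ f' b a"
    "\<forall>\<^sub>F p in nhds a. f' (f p) = p" "\<forall>\<^sub>F q in nhds b. f (f' q) = q"
    using assms(1) by (auto simp: diffeo_germ_def)
  obtain g' where g: "smooth_germ g b c" "smooth_germ g' c b"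
    "\<forall>\<^sub>F p in nhds b. g' (g p) = p" "\<forall>\<^sub>F q in nhds c. g (g' q) = q"
    using assms(2) by (auto simp: diffeo_germ_def)
  have "\<forall>\<^sub>F p in nhds a. f' (g' (g (f p))) = p"
    using eventually_compose_filterlim[OF g(3) smooth_germ_tendsto[OF f(1)]] f(3)
    by eventually_elim simp
  moreover have "\<forall>\<^sub>F q in nhds c. g (f (f' (g' q))) = q"
    using eventually_compose_filterlim[OF f(4) smooth_germ_tendsto[OF g(2)]] g(4)
    by eventually_elim simp
  ultimately show ?thesis
    using smooth_germ_compose[OF g(1) f(1)] smooth_germ_compose[OF f(2) g(2)]
    unfolding diffeo_germ_def by blast
qed

lemma diffeo_germ_obtain_inverse:
  assumes "diffeo_germ f a b"
  obtains g where "diffeo_germ g b a" "\<forall>\<^sub>F p in nhds a. g (f p) = p"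
  using assms unfolding diffeo_germ_def by blast

lemma diffeo_germ_apsnd:
  fixes h :: "real \<Rightarrow> real" and a :: real
  assumes "diffeo_germ h b c"
  shows "diffeo_germ (\<lambda>p. (fst p, h (snd p))) (a, b) (a, c)"
proof -
  have smooth: "smooth_germ (\<lambda>p. (fst p, h (snd p))) (a, b) (a, c)"
    if "smooth_germ h b c" for h :: "real \<Rightarrow> real" and b c
    by (intro smooth_germ_Pair smooth_germ_compose[OF that] smooth_germ_linear
        bounded_linear_fst bounded_linear_snd) auto
  obtain g where g: "smooth_germ h b c" "smooth_germ g c b"
    "\<forall>\<^sub>F p in nhds b. g (h p) = p" "\<forall>\<^sub>F q in nhds c. h (g q) = q"
    using assms by (auto simp: diffeo_germ_def)
  have snd: "filterlim snd (nhds y) (nhds (a, y))" for y :: real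
    by (intro smooth_germ_tendsto smooth_germ_linear bounded_linear_snd) simp
  have "\<forall>\<^sub>F p in nhds (a, b). g (h (snd p)) = snd p"
    by (rule eventually_compose_filterlim[OF g(3) snd])
  moreover have "\<forall>\<^sub>F p in nhds (a, c). h (g (snd p)) = snd p"
    by (rule eventually_compose_filterlim[OF g(4) snd])
  ultimately show ?thesis
    unfolding diffeo_germ_def
    by (intro conjI smooth g exI[of _ "\<lambda>p. (fst p, g (snd p))"]) (simp_all add: prod_eq_iff)
qed

text \<open>
  The inverse function theorem provides a differentiable local inverse \<open>g\<close>. The identity
  \<open>g' = 1 / f'(g)\<close> then bootstraps its regularity: if \<open>g\<close> is \<open>C\<^sup>n\<close>, the right-hand side is \<open>C\<^sup>n\<close>,
  so \<open>g\<close> is \<open>C\<^sup>n\<^sup>+\<^sup>1\<close>.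
\<close>

lemma smooth_germ_deriv_nonzero_imp_diffeo_germ:
  fixes f :: "real \<Rightarrow> real"
  assumes "smooth_germ f a b" "deriv f a \<noteq> 0"
  shows "diffeo_germ f a b"
proof -
  obtain U where U: "open U" "a \<in> U" and sm: "cont_diff_on n f U" and fa: "f a = b" for n
    using assms(1) by (auto simp: smooth_germ_def smooth_on_def)
  have sm': "cont_diff_on n (deriv f) U" for n
    by (rule cont_diff_on_deriv[OF U(1) sm])
  have D: "(f has_field_derivative deriv f x) (at x)" if "x \<in> U" for x
    by (rule cont_diff_on_Suc_real_has_deriv[OF sm that])
  have "(f has_derivative blinfun_apply (blinfun_mult_right (deriv f x))) (at x)" if "x \<in> U" for x
    using D[OF that] by (simp add: has_field_derivative_def)
  moreover have "continuous_on U (\<lambda>x. blinfun_mult_right (deriv f x))"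
    using sm'[of 0] by (auto intro!: bounded_linear.continuous_on[OF bounded_linear_blinfun_mult_right])
  moreover have "blinfun_mult_right (inverse (deriv f a)) o\<^sub>L blinfun_mult_right (deriv f a)
      = id_blinfun"
    using assms(2) by (intro blinfun_eqI) simp
  ultimately obtain U' V g g' where V: "open U'" "U' \<subseteq> U" "a \<in> U'" "open V" "f a \<in> V"
    and hom: "homeomorphism U' V f g"
    and g': "\<And>y. y \<in> V \<Longrightarrow> (g has_derivative g' y) (at y)"
    using inverse_function_theorem[OF U(1) _ _ U(2)] by metis
  have gV: "g y \<in> U" and fg: "f (g y) = y" if "y \<in> V" for y
    using hom V(2) that by (auto simp: homeomorphism_def)
  \<comment> \<open>differentiating \<open>f \<circ> g = id\<close> shows both \<open>f'(g) \<noteq> 0\<close> on all of \<open>V\<close> and the formula for \<open>g'\<close>\<close>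
  have inv: "deriv f (g y) * g' y 1 = 1" if "y \<in> V" for y
  proof -
    have "((\<lambda>y. f (g y)) has_derivative (\<lambda>v. deriv f (g y) * g' y v)) (at y)"
      by (rule has_derivative_compose[OF g'[OF that]
            D[OF gV[OF that], unfolded has_field_derivative_def]])
    moreover have "((\<lambda>y. f (g y)) has_derivative (\<lambda>v. v)) (at y)"
      by (rule has_derivative_transform_within_open[OF has_derivative_ident V(4) that])
        (simp add: fg)
    ultimately show ?thesis
      using has_derivative_unique by metis
  qed
  have Dg: "(g has_field_derivative inverse (deriv f (g y))) (at y)" if "y \<in> V" for y
  proof -
    have "g' y 1 = inverse (deriv f (g y))"
      using inv[OF that] by (metis inverse_unique)
    then have "g' y v = inverse (deriv f (g y)) * v" for v
      using linear_scale[OF has_derivative_linear[OF g'[OF that]], of v 1] by simp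
    then have "g' y = (*) (inverse (deriv f (g y)))" by (rule ext)
    then show ?thesis
      using g'[OF that] by (simp add: has_field_derivative_def)
  qed
  have "cont_diff_on n g V" for n
  proof (induction n)
    case 0
    then show ?case using hom by (simp add: homeomorphism_def)
  next
    case (Suc n)
    have "cont_diff_on n (\<lambda>y. inverse (deriv f (g y))) V"
    proof (rule cont_diff_on_compose[OF V(4) _ _ cont_diff_on_inverse])
      show "(\<lambda>y. deriv f (g y)) ` V \<subseteq> - {0}" using inv by fastforce
      show "cont_diff_on n (\<lambda>y. deriv f (g y)) V"
        by (rule cont_diff_on_compose[OF V(4) U(1) _ sm' Suc]) (use gV in auto)
    qed auto
    then show ?case by (intro cont_diff_on_Suc_realI[OF V(4) Dg])
  qed
  then have "smooth_germ g b a"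
    using V hom fa by (auto simp: smooth_germ_def smooth_on_def homeomorphism_def)
  moreover have "\<forall>\<^sub>F p in nhds a. g (f p) = p"
    using V(1,3) hom by (auto simp: eventually_nhds homeomorphism_def)
  moreover have "\<forall>\<^sub>F q in nhds b. f (g q) = q"
    using V(4,5) fg fa by (auto simp: eventually_nhds)
  ultimately show ?thesis using assms(1) by (auto simp: diffeo_germ_def)
qed

section \<open>The normal form\<close>

text \<open>
  Writing \<open>x(t) = (t - t\<^sub>0)\<^sup>m u(t)\<close> with \<open>u(t\<^sub>0) \<noteq> 0\<close>, the coordinate is
  \<open>\<phi>(t) = (t - t\<^sub>0) \<bar>u(t)\<bar>\<^sup>1\<^sup>/\<^sup>m\<close>: near \<open>t\<^sub>0\<close> the factor under the root has no zero, so \<open>\<phi>\<close> is smooth,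
  and \<open>\<phi>'(t\<^sub>0) = \<bar>u(t\<^sub>0)\<bar>\<^sup>1\<^sup>/\<^sup>m\<close> does not vanish.
\<close>

lemma has_ord_eq_signed_power:
  fixes x :: "real \<Rightarrow> real"
  assumes "smooth_germ x t0 c" "has_ord x t0 m" "m > 0"
  obtains \<epsilon> :: real and \<phi> where "\<epsilon> \<in> {1, -1}" "diffeo_germ \<phi> t0 0"
    "\<forall>\<^sub>F t in nhds t0. x t = \<epsilon> * \<phi> t ^ m"
proof -
  obtain U where "open U" "t0 \<in> U" "smooth_on x U"
    using assms(1) by (auto simp: smooth_germ_def)
  then obtain r where r: "r > 0" "ball t0 r \<subseteq> U" by (meson openE)
  then have "smooth_on x (ball t0 r)"
    using \<open>smooth_on x U\<close> cont_diff_on_subset unfolding smooth_on_def by blast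
  from has_ord_factor[OF r(1) this assms(2)] obtain u where
    u: "smooth_on u (ball t0 r)" "u t0 \<noteq> 0"
    and xu: "\<And>t. t \<in> ball t0 r \<Longrightarrow> x t = (t - t0) ^ m * u t" by blast
  define \<epsilon> where "\<epsilon> = sgn (u t0)"
  have \<epsilon>: "\<epsilon> \<in> {1, -1}" "\<epsilon> * \<epsilon> = 1" "\<epsilon> * u t0 > 0"
    using u(2) by (auto simp: \<epsilon>_def sgn_if)
  have o: "open {0::real<..}" by simp
  have cu: "cont_diff_on n (\<lambda>t. \<epsilon> * u t) (ball t0 r)" for n
    using u(1) by (intro cont_diff_on_mult cont_diff_on_const) (auto simp: smooth_on_def)
  \<comment> \<open>where \<open>\<epsilon> u\<close> is positive it equals \<open>\<bar>u\<bar>\<close>, and its real powers are smooth\<close>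
  define S where "S = ball t0 r \<inter> (\<lambda>t. \<epsilon> * u t) -` {0<..}"
  have S: "open S" "t0 \<in> S" "S \<subseteq> ball t0 r"
    using cu[of 0] \<epsilon> r(1) continuous_open_preimage[OF _ open_ball o] by (auto simp: S_def)
  define w where "w t = (\<epsilon> * u t) powr (1 / m)" for t
  have w: "cont_diff_on n w S" for n
    unfolding w_def
    by (rule cont_diff_on_compose[OF S(1) o _ cont_diff_on_powr cont_diff_on_subset[OF cu S(3)]])
      (auto simp: S_def)
  define \<phi> where "\<phi> t = (t + (- t0)) * w t" for t
  have "cont_diff_on n \<phi> S" for n
    unfolding \<phi>_def
    by (intro cont_diff_on_mult cont_diff_on_add cont_diff_on_const w S(1)
        cont_diff_on_linear[OF bounded_linear_ident])
  then have "smooth_germ \<phi> t0 0"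
    using S by (auto simp: smooth_germ_def smooth_on_def \<phi>_def)
  moreover have "deriv \<phi> t0 \<noteq> 0"
  proof -
    have "(\<phi> has_field_derivative w t0) (at t0)"
      unfolding \<phi>_def using cont_diff_on_Suc_real_has_deriv[OF w S(2)]
      by (auto intro!: derivative_eq_intros)
    then show ?thesis using \<epsilon>(3) by (auto simp: DERIV_imp_deriv w_def)
  qed
  ultimately have "diffeo_germ \<phi> t0 0"
    by (rule smooth_germ_deriv_nonzero_imp_diffeo_germ)
  moreover have "x t = \<epsilon> * \<phi> t ^ m" if "t \<in> S" for t
  proof -
    have "w t ^ m = \<epsilon> * u t"
    proof -
      have pos: "\<epsilon> * u t > 0" using that by (simp add: S_def)
      then have "w t > 0" unfolding w_def by (simp only: powr_gt_zero)
      then have "w t ^ m = w t powr m" by (rule powr_realpow[symmetric])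
      also have "\<dots> = (\<epsilon> * u t) powr 1" using assms(3) by (simp add: w_def powr_powr)
      finally show ?thesis using pos by simp
    qed
    then have "\<epsilon> * \<phi> t ^ m = (\<epsilon> * \<epsilon>) * ((t - t0) ^ m * u t)"
      by (simp add: \<phi>_def power_mult_distrib)
    also have "\<dots> = x t" using xu[of t] that S(3) \<epsilon>(2) by auto
    finally show ?thesis ..
  qed
  then have "\<forall>\<^sub>F t in nhds t0. x t = \<epsilon> * \<phi> t ^ m"
    using S(1,2) by (auto simp: eventually_nhds)
  ultimately show thesis using that \<epsilon>(1) by blast
qed

theorem proposition3p25:
  fixes x z :: "real \<Rightarrow> real" and t0 :: real and k :: nat
  assumes "smooth_germ (\<lambda>t. (x t, z t)) t0 (0, 0)"
    and "has_ord x t0 (k + 1)"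
    and "deriv z t0 \<noteq> 0"
  shows "\<exists>\<epsilon>\<in>{1, -1 :: real}. \<exists>(\<phi> :: real \<Rightarrow> real) (\<psi> :: real \<times> real \<Rightarrow> real \<times> real)
           (\<eta> :: real \<times> real \<Rightarrow> real).
           diffeo_germ \<phi> t0 0 \<and>
           diffeo_germ \<psi> (0, 0) (0, 0) \<and>
           smooth_germ \<eta> (0, 0) 0 \<and>
           (\<forall>\<^sub>F (X, Z) in nhds (0, 0). \<psi> (X, Z) = (X, \<eta> (X\<^sup>2, Z))) \<and>
           (\<forall>\<^sub>F t in nhds t0. \<psi> (x t, z t) = (\<epsilon> * \<phi> t ^ (k + 1), \<phi> t))"
proof -
  have x: "smooth_germ x t0 0" and z: "smooth_germ z t0 0"
    using smooth_germ_linear_compose[OF bounded_linear_fst assms(1)]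
      smooth_germ_linear_compose[OF bounded_linear_snd assms(1)] by simp_all
  obtain \<epsilon> \<phi> where \<epsilon>: "\<epsilon> \<in> {1, -1 :: real}" and \<phi>: "diffeo_germ \<phi> t0 0"
    and x_eq: "\<forall>\<^sub>F t in nhds t0. x t = \<epsilon> * \<phi> t ^ (k + 1)"
    using has_ord_eq_signed_power[OF x assms(2)] by auto
  obtain \<zeta> where \<zeta>: "diffeo_germ \<zeta> 0 t0" and \<zeta>z: "\<forall>\<^sub>F t in nhds t0. \<zeta> (z t) = t"
    using diffeo_germ_obtain_inverse[OF
        smooth_germ_deriv_nonzero_imp_diffeo_germ[OF z assms(3)]] .
  define h where "h Z = \<phi> (\<zeta> Z)" for Z
  have h: "diffeo_germ h 0 0"
    unfolding h_def by (rule diffeo_germ_compose[OF \<zeta> \<phi>])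
  define \<psi> where "\<psi> p = (fst p, h (snd p))" for p :: "real \<times> real"
  define \<eta> where "\<eta> p = h (snd p)" for p :: "real \<times> real"
  have "diffeo_germ \<psi> (0, 0) (0, 0)"
    unfolding \<psi>_def by (rule diffeo_germ_apsnd[OF h])
  moreover have "smooth_germ \<eta> (0, 0) 0"
    unfolding \<eta>_def
  proof (rule smooth_germ_compose[where f = snd and g = h])
    show "smooth_germ h 0 0" using h by (simp add: diffeo_germ_def)
    show "smooth_germ snd (0, 0 :: real) (0 :: real)"
      by (rule smooth_germ_linear[OF bounded_linear_snd]) simp
  qed
  moreover have "\<forall>\<^sub>F (X, Z) in nhds (0, 0). \<psi> (X, Z) = (X, \<eta> (X\<^sup>2, Z))"
    by (rule always_eventually) (simp add: \<psi>_def \<eta>_def)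
  moreover have "\<forall>\<^sub>F t in nhds t0. \<psi> (x t, z t) = (\<epsilon> * \<phi> t ^ (k + 1), \<phi> t)"
    using x_eq \<zeta>z by eventually_elim (simp add: \<psi>_def h_def)
  ultimately show ?thesis using \<epsilon> \<phi> by blast
qed

end
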